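(* Let $(G,\precsim)$ be a C-quasi-ordered group and let $g\in G$ be $o^+$-type. The type-component $T_g$ has the following properties: (a) $T_g$ is right-convex with convexity complement $F_g:=cl(g^{-1})\setminus T_g$. Moreover, $cl(g^{-1})=F_g\cup T_g^-$ and $F_g$ can only contain v-type elements. (b) $T_g$ is convex if and only if $g^{-1}$ is not a welding point of $G$. (c) $T_g$ is the biggest strictly convex subset of $G$ containing $g$ with the following properties: (i) every element of $T_g$ is o-type; (ii) $T_g$ contains exactly one class of $o^-$-type elements, and this class is smaller than every $o^+$-type element of $T_g$. (d) For any $f_1,f_2,h\in T_g$ which are $o^+$-type, $f_1\precsim f_2$ implies $f_1h\precsim f_2h$ and $hf_1\precsim hf_2$.
   Context: A quasi-order is a reflexive, transitive and total binary relation $\precsim$; $a\sim b$ means $a\precsim b\precsim a$, $cl(a)$ is the $\sim$-class of $a$, and $a\precnsim b$ means $a\precsim b$ and $a\nsim b$. An element $c$ is between $a$ and $b$ if $a\precsim c\precsim b$ or $b\precsim c\precsim a$. A subset $S$ is convex (resp. strictly convex, right-convex) if for all $s,t\in S$, $s\precsim a\precsim t$ (resp. $s\precnsim a\precnsim t$, $s\precnsim a\precsim t$) implies $a\in S$. The convexity complement of a strictly convex set $S$ is the smallest set $T$ disjoint from $S$ such that $S\cup T$ is convex. A C-relation on a set is a ternary relation $C$ such that for all $x,y,z,w$: $C(x,y,z)\Rightarrow C(x,z,y)$; $C(x,y,z)\Rightarrow\neg C(y,x,z)$; $C(x,y,z)\Rightarrow C(w,y,z)\vee C(x,w,z)$;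 $x\neq y\Rightarrow C(x,y,y)$. On a group it is compatible if $C(x,y,z)$ implies $C(vxu,vyu,vzu)$ for all $x,y,z,u,v$. A C-quasi-order on a group $G$ is a quasi-order of the form $x\precsim y\Leftrightarrow\neg C(x,y,1)$ with $C$ a compatible C-relation; a C-quasi-ordered group is a group with a C-quasi-order. $g\in G$ is v-type if $g\sim g^{-1}$; o-type if $g=1$ or $g\nsim g^{-1}$; $o^+$-type if $g^{-1}\precnsim g$; $o^-$-type if $g\precnsim g^{-1}$. An element $h$ is a welding point of $G$ if there exists $g\sim h$ such that $g$ and $h$ are of different type (one is v-type, the other o-type). For $g$ $o^+$-type, $T_g^+$ is the set of $o^+$-type elements $h$ such that every element between $g$ and $h$ is $o^+$-type, $T_g^-:=\{h^{-1}\mid h\in T_g^+\}$ and $T_g:=T_g^+\cup T_g^-$ (the type-component of $g$). "Exactly one class of $o^-$-type elements" means that there are $o^-$-type elements in the set and that they are all $\sim$-equivalent to one another.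
   Formalization: In (c), the competing strictly convex subsets are also required not to contain the neutral element 1: 1 is o-type by definition, and for the integers with their usual order (g = 1) the whole group satisfies (i) and (ii) but is bigger than T_g = Z\{0}. *)

theory Defs
  imports "HOL-Algebra.Group"
begin

section \<open>Quasi-orders and convexity\<close>

text \<open>
  A relation on a set \<open>A\<close> is a predicate on the ambient type, of which only the restriction to
  \<open>A\<close> matters. Together with reflexivity, \<^const>\<open>totalp_on\<close> gives \<open>leq x y \<or> leq y x\<close> for all
  \<open>x, y \<in> A\<close>.
\<close>

definition quasi_order_on :: "'a set \<Rightarrow> ('a \<Rightarrow> 'a \<Rightarrow> bool) \<Rightarrow> bool" where
  "quasi_order_on A leq \<longleftrightarrow> reflp_on A leq \<and> transp_on A leq \<and> totalp_on A leq"

definition qo_equiv :: "('a \<Rightarrow> 'a \<Rightarrow> bool) \<Rightarrow> 'a \<Rightarrow> 'a \<Rightarrow> bool" where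
  "qo_equiv leq a b \<longleftrightarrow> leq a b \<and> leq b a"

definition qo_less :: "('a \<Rightarrow> 'a \<Rightarrow> bool) \<Rightarrow> 'a \<Rightarrow> 'a \<Rightarrow> bool" where
  "qo_less leq a b \<longleftrightarrow> leq a b \<and> \<not> qo_equiv leq a b"

definition qo_class :: "'a set \<Rightarrow> ('a \<Rightarrow> 'a \<Rightarrow> bool) \<Rightarrow> 'a \<Rightarrow> 'a set" where
  "qo_class A leq a = {b \<in> A. qo_equiv leq a b}"

definition qo_between :: "('a \<Rightarrow> 'a \<Rightarrow> bool) \<Rightarrow> 'a \<Rightarrow> 'a \<Rightarrow> 'a \<Rightarrow> bool" where
  "qo_between leq a b c \<longleftrightarrow> leq a c \<and> leq c b \<or> leq b c \<and> leq c a"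

definition qo_convex :: "'a set \<Rightarrow> ('a \<Rightarrow> 'a \<Rightarrow> bool) \<Rightarrow> 'a set \<Rightarrow> bool" where
  "qo_convex A leq S \<longleftrightarrow> S \<subseteq> A \<and> (\<forall>s\<in>S. \<forall>t\<in>S. \<forall>a\<in>A. leq s a \<and> leq a t \<longrightarrow> a \<in> S)"

definition qo_strictly_convex :: "'a set \<Rightarrow> ('a \<Rightarrow> 'a \<Rightarrow> bool) \<Rightarrow> 'a set \<Rightarrow> bool" where
  "qo_strictly_convex A leq S \<longleftrightarrow>
     S \<subseteq> A \<and> (\<forall>s\<in>S. \<forall>t\<in>S. \<forall>a\<in>A. qo_less leq s a \<and> qo_less leq a t \<longrightarrow> a \<in> S)"

definition qo_right_convex :: "'a set \<Rightarrow> ('a \<Rightarrow> 'a \<Rightarrow> bool) \<Rightarrow> 'a set \<Rightarrow> bool" where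
  "qo_right_convex A leq S \<longleftrightarrow>
     S \<subseteq> A \<and> (\<forall>s\<in>S. \<forall>t\<in>S. \<forall>a\<in>A. qo_less leq s a \<and> leq a t \<longrightarrow> a \<in> S)"

definition is_convexity_complement ::
  "'a set \<Rightarrow> ('a \<Rightarrow> 'a \<Rightarrow> bool) \<Rightarrow> 'a set \<Rightarrow> 'a set \<Rightarrow> bool" where
  "is_convexity_complement A leq S T \<longleftrightarrow>
     qo_strictly_convex A leq S \<and>
     S \<inter> T = {} \<and> qo_convex A leq (S \<union> T) \<and>
     (\<forall>T'. S \<inter> T' = {} \<and> qo_convex A leq (S \<union> T') \<longrightarrow> T \<subseteq> T')"


section \<open>C-relations and C-quasi-ordered groups\<close>

definition C_relation_on :: "'a set \<Rightarrow> ('a \<Rightarrow> 'a \<Rightarrow> 'a \<Rightarrow> bool) \<Rightarrow> bool" where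
  "C_relation_on A C \<longleftrightarrow>
     (\<forall>x\<in>A. \<forall>y\<in>A. \<forall>z\<in>A. C x y z \<longrightarrow> C x z y) \<and>
     (\<forall>x\<in>A. \<forall>y\<in>A. \<forall>z\<in>A. C x y z \<longrightarrow> \<not> C y x z) \<and>
     (\<forall>x\<in>A. \<forall>y\<in>A. \<forall>z\<in>A. \<forall>w\<in>A. C x y z \<longrightarrow> C w y z \<or> C x w z) \<and>
     (\<forall>x\<in>A. \<forall>y\<in>A. x \<noteq> y \<longrightarrow> C x y y)"

definition compatible_C :: "('a, 'b) monoid_scheme \<Rightarrow> ('a \<Rightarrow> 'a \<Rightarrow> 'a \<Rightarrow> bool) \<Rightarrow> bool" where
  "compatible_C G C \<longleftrightarrow>
     (\<forall>x\<in>carrier G. \<forall>y\<in>carrier G. \<forall>z\<in>carrier G. \<forall>u\<in>carrier G. \<forall>v\<in>carrier G.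
        C x y z \<longrightarrow>
        C (v \<otimes>\<^bsub>G\<^esub> x \<otimes>\<^bsub>G\<^esub> u) (v \<otimes>\<^bsub>G\<^esub> y \<otimes>\<^bsub>G\<^esub> u) (v \<otimes>\<^bsub>G\<^esub> z \<otimes>\<^bsub>G\<^esub> u))"

definition C_quasi_order :: "('a, 'b) monoid_scheme \<Rightarrow> ('a \<Rightarrow> 'a \<Rightarrow> bool) \<Rightarrow> bool" where
  "C_quasi_order G leq \<longleftrightarrow>
     quasi_order_on (carrier G) leq \<and>
     (\<exists>C. C_relation_on (carrier G) C \<and> compatible_C G C \<and>
          (\<forall>x\<in>carrier G. \<forall>y\<in>carrier G. leq x y \<longleftrightarrow> \<not> C x y \<one>\<^bsub>G\<^esub>))"

locale C_quasi_ordered_group = group G for G (structure) +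
  fixes leq :: "'a \<Rightarrow> 'a \<Rightarrow> bool"
  assumes C_quasi_order: "C_quasi_order G leq"


section \<open>Types of elements\<close>

definition v_type :: "('a, 'b) monoid_scheme \<Rightarrow> ('a \<Rightarrow> 'a \<Rightarrow> bool) \<Rightarrow> 'a \<Rightarrow> bool" where
  "v_type G leq g \<longleftrightarrow> qo_equiv leq g (inv\<^bsub>G\<^esub> g)"

definition o_type :: "('a, 'b) monoid_scheme \<Rightarrow> ('a \<Rightarrow> 'a \<Rightarrow> bool) \<Rightarrow> 'a \<Rightarrow> bool" where
  "o_type G leq g \<longleftrightarrow> g = \<one>\<^bsub>G\<^esub> \<or> \<not> qo_equiv leq g (inv\<^bsub>G\<^esub> g)"

definition o_plus_type :: "('a, 'b) monoid_scheme \<Rightarrow> ('a \<Rightarrow> 'a \<Rightarrow> bool) \<Rightarrow> 'a \<Rightarrow> bool" where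
  "o_plus_type G leq g \<longleftrightarrow> qo_less leq (inv\<^bsub>G\<^esub> g) g"

definition o_minus_type :: "('a, 'b) monoid_scheme \<Rightarrow> ('a \<Rightarrow> 'a \<Rightarrow> bool) \<Rightarrow> 'a \<Rightarrow> bool" where
  "o_minus_type G leq g \<longleftrightarrow> qo_less leq g (inv\<^bsub>G\<^esub> g)"

text \<open>
  The neutral element is both v-type and o-type, every other element is exactly one of the two.
  The clause \<open>g \<noteq> h\<close> below therefore only matters for the neutral element (which is alone in its
  class): it is not of a type different from its own.
\<close>

definition welding_point :: "('a, 'b) monoid_scheme \<Rightarrow> ('a \<Rightarrow> 'a \<Rightarrow> bool) \<Rightarrow> 'a \<Rightarrow> bool" where
  "welding_point G leq h \<longleftrightarrow>
     (\<exists>g\<in>carrier G. g \<noteq> h \<and> qo_equiv leq g h \<and>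
        (v_type G leq g \<and> o_type G leq h \<or> o_type G leq g \<and> v_type G leq h))"


section \<open>Type-components\<close>

definition type_comp_plus ::
  "('a, 'b) monoid_scheme \<Rightarrow> ('a \<Rightarrow> 'a \<Rightarrow> bool) \<Rightarrow> 'a \<Rightarrow> 'a set" where
  "type_comp_plus G leq g =
     {h \<in> carrier G. o_plus_type G leq h \<and>
        (\<forall>c\<in>carrier G. qo_between leq g h c \<longrightarrow> o_plus_type G leq c)}"

definition type_comp_minus ::
  "('a, 'b) monoid_scheme \<Rightarrow> ('a \<Rightarrow> 'a \<Rightarrow> bool) \<Rightarrow> 'a \<Rightarrow> 'a set" where
  "type_comp_minus G leq g = {inv\<^bsub>G\<^esub> h |h. h \<in> type_comp_plus G leq g}"

definition type_comp :: "('a, 'b) monoid_scheme \<Rightarrow> ('a \<Rightarrow> 'a \<Rightarrow> bool) \<Rightarrow> 'a \<Rightarrow> 'a set" where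
  "type_comp G leq g = type_comp_plus G leq g \<union> type_comp_minus G leq g"

definition type_comp_F :: "('a, 'b) monoid_scheme \<Rightarrow> ('a \<Rightarrow> 'a \<Rightarrow> bool) \<Rightarrow> 'a \<Rightarrow> 'a set" where
  "type_comp_F G leq g = qo_class (carrier G) leq (inv\<^bsub>G\<^esub> g) - type_comp G leq g"

definition one_o_minus_class ::
  "('a, 'b) monoid_scheme \<Rightarrow> ('a \<Rightarrow> 'a \<Rightarrow> bool) \<Rightarrow> 'a set \<Rightarrow> bool" where
  "one_o_minus_class G leq S \<longleftrightarrow>
     (\<exists>a\<in>S. o_minus_type G leq a) \<and>
     (\<forall>a\<in>S. \<forall>b\<in>S. o_minus_type G leq a \<and> o_minus_type G leq b \<longrightarrow> qo_equiv leq a b)"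

text \<open>
  The sets among which the type-component of \<open>g\<close> is the biggest. The neutral element has to be
  excluded: it is o-type, neither \<open>o\<^sup>+\<close>-type nor \<open>o\<^sup>-\<close>-type, and it is not in the
  type-component, so that for \<open>\<int>\<close> with the C-quasi-order of its usual order (the class of \<open>0\<close>
  first, then the class of all negative numbers, then the positive numbers in their order) the
  whole group would otherwise be a bigger set than the type-component \<open>\<int> - {0}\<close>.
\<close>

definition type_comp_candidate ::
  "('a, 'b) monoid_scheme \<Rightarrow> ('a \<Rightarrow> 'a \<Rightarrow> bool) \<Rightarrow> 'a \<Rightarrow> 'a set \<Rightarrow> bool" where
  "type_comp_candidate G leq g S \<longleftrightarrow>
     qo_strictly_convex (carrier G) leq S \<and> g \<in> S \<and> \<one>\<^bsub>G\<^esub> \<notin> S \<and>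
     (\<forall>a\<in>S. o_type G leq a) \<and>
     one_o_minus_class G leq S \<and>
     (\<forall>a\<in>S. \<forall>b\<in>S. o_minus_type G leq a \<and> o_plus_type G leq b \<longrightarrow> qo_less leq a b)"

end

theory Submission
  imports Defs
begin

text \<open>
  If \<open>a \<prec> b\<close> then translating \<open>C(b, a, 1)\<close> by \<open>a\<inverse>\<close> and by \<open>b\<inverse>\<close> yields
  \<open>a\<inverse> \<prec> a\<inverse>b, ba\<inverse>\<close> and \<open>b\<inverse> \<sim> ab\<inverse>, b\<inverse>a\<close>. These rules alone show that the inverse of
  an \<open>o\<^sup>+\<close>-type element is never equivalent to an \<open>o\<^sup>+\<close>-type element, and that
  \<open>h\<inverse> \<prec> a \<lesssim> h\<close> with \<open>h\<close> of \<open>o\<^sup>+\<close>-type forces \<open>a\<close> to be of \<open>o\<^sup>+\<close>-type with \<open>a\<inverse> \<sim> h\<inverse>\<close>. Hence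
  \<open>T\<^sub>g\<^sup>+\<close> consists of the \<open>o\<^sup>+\<close>-type \<open>h\<close> with \<open>h\<inverse> \<sim> g\<inverse>\<close>, and \<open>T\<^sub>g\<^sup>-\<close> of the \<open>o\<^sup>-\<close>-type elements
  of \<open>cl(g\<inverse>)\<close>, from which everything follows by order arguments.
\<close>

context C_quasi_ordered_group
begin

section \<open>Notation and elementary order facts\<close>

notation leq (infix "\<lesssim>" 50)

abbreviation less (infix "\<prec>" 50) where "x \<prec> y \<equiv> qo_less (\<lesssim>) x y"
abbreviation equiv (infix "\<sim>" 50) where "x \<sim> y \<equiv> qo_equiv (\<lesssim>) x y"
abbreviation o_plus where "o_plus x \<equiv> o_plus_type G (\<lesssim>) x"
abbreviation o_minus where "o_minus x \<equiv> o_minus_type G (\<lesssim>) x"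

lemma leq_refl: "x \<in> carrier G \<Longrightarrow> x \<lesssim> x"
  using C_quasi_order by (auto simp: C_quasi_order_def quasi_order_on_def reflp_on_def)

lemma leq_trans:
  "\<lbrakk>x \<lesssim> y; y \<lesssim> z; x \<in> carrier G; y \<in> carrier G; z \<in> carrier G\<rbrakk> \<Longrightarrow> x \<lesssim> z"
  using C_quasi_order unfolding C_quasi_order_def quasi_order_on_def
  by (meson transp_onD)

lemma leq_total: "\<lbrakk>x \<in> carrier G; y \<in> carrier G\<rbrakk> \<Longrightarrow> x \<lesssim> y \<or> y \<lesssim> x"
  using C_quasi_order leq_refl
  unfolding C_quasi_order_def quasi_order_on_def totalp_on_def by metis

lemma less_iff: "\<lbrakk>x \<in> carrier G; y \<in> carrier G\<rbrakk> \<Longrightarrow> x \<prec> y \<longleftrightarrow> \<not> y \<lesssim> x"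
  using leq_total by (auto simp: qo_less_def qo_equiv_def)

lemma less_cases:
  assumes "x \<in> carrier G" "y \<in> carrier G"
  obtains "x \<prec> y" | "x \<sim> y" | "y \<prec> x"
  using assms leq_total by (auto simp: qo_less_def qo_equiv_def)

lemma equiv_iff: "\<lbrakk>x \<in> carrier G; y \<in> carrier G\<rbrakk> \<Longrightarrow> x \<sim> y \<longleftrightarrow> \<not> x \<prec> y \<and> \<not> y \<prec> x"
  by (auto simp: less_iff qo_equiv_def)

section \<open>Translation rules coming from the C-relation\<close>

lemma C_relation_obtain:
  obtains C where "C_relation_on (carrier G) C" "compatible_C G C"
    "\<And>x y. \<lbrakk>x \<in> carrier G; y \<in> carrier G\<rbrakk> \<Longrightarrow> y \<prec> x \<longleftrightarrow> C x y \<one>"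
proof -
  obtain C where "C_relation_on (carrier G) C" "compatible_C G C"
    and "\<forall>x\<in>carrier G. \<forall>y\<in>carrier G. x \<lesssim> y \<longleftrightarrow> \<not> C x y \<one>"
    using C_quasi_order unfolding C_quasi_order_def by blast
  then show thesis
    by (intro that[of C]) (simp_all add: less_iff)
qed

lemma C_translate:
  assumes "compatible_C G C" "C x y z"
    "x \<in> carrier G" "y \<in> carrier G" "z \<in> carrier G" "u \<in> carrier G"
  shows "C (x \<otimes> u) (y \<otimes> u) (z \<otimes> u)" "C (u \<otimes> x) (u \<otimes> y) (u \<otimes> z)"
proof -
  have "C (v \<otimes> x \<otimes> w) (v \<otimes> y \<otimes> w) (v \<otimes> z \<otimes> w)"
    if "v \<in> carrier G" "w \<in> carrier G" for v w
    using assms that unfolding compatible_C_def by blast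
  from this[of \<one> u] this[of u \<one>]
  show "C (x \<otimes> u) (y \<otimes> u) (z \<otimes> u)" "C (u \<otimes> x) (u \<otimes> y) (u \<otimes> z)"
    using assms by simp_all
qed

text \<open>These four rules carry all later computations with products. Translation by
  \<open>inv a\<close> moves the neutral element to the second place of the triple, and translation
  by \<open>inv b\<close> moves it to the first.\<close>

lemma less_translate:
  assumes "a \<prec> b" and [simp]: "a \<in> carrier G" "b \<in> carrier G"
  shows "inv a \<prec> b \<otimes> inv a" "inv a \<prec> inv a \<otimes> b"
    "a \<otimes> inv b \<sim> inv b" "inv b \<otimes> a \<sim> inv b"
proof -
  obtain C where C: "C_relation_on (carrier G) C" "compatible_C G C"
    and less: "\<And>x y. \<lbrakk>x \<in> carrier G; y \<in> carrier G\<rbrakk> \<Longrightarrow> y \<prec> x \<longleftrightarrow> C x y \<one>"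
    by (rule C_relation_obtain) blast
  have sym: "C x y z \<Longrightarrow> C x z y" and asym: "C x y z \<Longrightarrow> \<not> C y x z"
    if "x \<in> carrier G" "y \<in> carrier G" "z \<in> carrier G" for x y z
    using C(1) that unfolding C_relation_on_def by blast+
  have Cba: "C b a \<one>"
    using assms less by simp
  note tr = C_translate[OF C(2) Cba assms(3,2) one_closed]
  \<comment> \<open>Symmetry in the last two arguments brings \<open>\<one>\<close> to the last
    place, where \<open>less\<close> reads the triple as a strict inequality.\<close>
  have "C (b \<otimes> inv a) \<one> (inv a)" "C (inv a \<otimes> b) \<one> (inv a)"
    using tr[of "inv a"] by simp_all
  then show "inv a \<prec> b \<otimes> inv a" "inv a \<prec> inv a \<otimes> b"
    by (simp_all add: less sym)
  \<comment> \<open>With \<open>\<one>\<close> in front, asymmetry applied to both orders of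
    \<open>x\<close> and \<open>y\<close> refutes \<open>x \<prec> y\<close> and
    \<open>y \<prec> x\<close>.\<close>
  have eq: "x \<sim> y" if xy: "C \<one> x y" and [simp]: "x \<in> carrier G" "y \<in> carrier G" for x y
  proof -
    have "\<not> C x \<one> y" "\<not> C y \<one> x"
      using asym[OF _ _ _ xy] asym[OF _ _ _ sym[OF _ _ _ xy]] by simp_all
    then have "\<not> C x y \<one>" "\<not> C y x \<one>"
      using sym[of x y \<one>] sym[of y x \<one>] by auto
    then show ?thesis
      by (simp add: equiv_iff less)
  qed
  have "C \<one> (a \<otimes> inv b) (inv b)" "C \<one> (inv b \<otimes> a) (inv b)"
    using tr[of "inv b"] by simp_all
  then show "a \<otimes> inv b \<sim> inv b" "inv b \<otimes> a \<sim> inv b"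
    by (simp_all add: eq)
qed

text \<open>Translation by \<open>inv h\<close> reduces both claims to the single statement that
  \<open>C f1 f2 (inv h)\<close> fails.\<close>

lemma mult_mono:
  assumes "f1 \<lesssim> f2" "inv h \<prec> f2"
    and [simp]: "f1 \<in> carrier G" "f2 \<in> carrier G" "h \<in> carrier G"
  shows "f1 \<otimes> h \<lesssim> f2 \<otimes> h" "h \<otimes> f1 \<lesssim> h \<otimes> f2"
proof -
  obtain C where C: "C_relation_on (carrier G) C" "compatible_C G C"
    and less: "\<And>x y. \<lbrakk>x \<in> carrier G; y \<in> carrier G\<rbrakk> \<Longrightarrow> y \<prec> x \<longleftrightarrow> C x y \<one>"
    by (rule C_relation_obtain) blast
  have sym: "C x y z \<Longrightarrow> C x z y" and asym: "C x y z \<Longrightarrow> \<not> C y x z"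
    if "x \<in> carrier G" "y \<in> carrier G" "z \<in> carrier G" for x y z
    using C(1) that unfolding C_relation_on_def by blast+
  have C3: "C w y z \<or> C x w z" if "C x y z"
    "x \<in> carrier G" "y \<in> carrier G" "z \<in> carrier G" "w \<in> carrier G" for x y z w
    using C(1) that unfolding C_relation_on_def by blast
  have leq: "x \<lesssim> y" if "\<not> C x y \<one>" "x \<in> carrier G" "y \<in> carrier G" for x y
    using less[of x y] that less_iff by blast
  have "\<not> C f1 f2 \<one>" "C f2 (inv h) \<one>"
    using assms less[of f1 f2] less[of f2 "inv h"] by (auto simp: less_iff)
  \<comment> \<open>Inserting \<open>\<one>\<close> as the fourth point leaves
    \<open>C f1 \<one> f2\<close>, contrary to \<open>f1 \<lesssim> f2\<close>, or
    \<open>C \<one> (inv h) f2\<close>, contrary by asymmetry to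
    \<open>inv h \<prec> f2\<close>.\<close>
  then have *: "\<not> C f1 f2 (inv h)"
    using C3[of f1 "inv h" f2 \<one>] sym[of f1 f2 "inv h"] sym[of f1 \<one> f2] sym[of \<one> "inv h" f2]
      sym[of f2 "inv h" \<one>] asym[of f2 \<one> "inv h"] by auto
  show "f1 \<otimes> h \<lesssim> f2 \<otimes> h"
  proof (rule leq)
    show "\<not> C (f1 \<otimes> h) (f2 \<otimes> h) \<one>"
      using * C_translate(1)[OF C(2), of "f1 \<otimes> h" "f2 \<otimes> h" \<one> "inv h"] by (auto simp: m_assoc)
  qed simp_all
  show "h \<otimes> f1 \<lesssim> h \<otimes> f2"
  proof (rule leq)
    show "\<not> C (h \<otimes> f1) (h \<otimes> f2) \<one>"
      using * C_translate(2)[OF C(2), of "h \<otimes> f1" "h \<otimes> f2" \<one> "inv h"]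
      by (auto simp: m_assoc[symmetric])
  qed simp_all
qed

section \<open>Chains mixing strict, weak and equivalent steps\<close>

lemma equiv_sym: "x \<sim> y \<Longrightarrow> y \<sim> x"
  by (simp add: qo_equiv_def)

lemma equiv_commute: "x \<sim> y \<longleftrightarrow> y \<sim> x"
  by (auto simp: qo_equiv_def)

lemma equiv_trans:
  "\<lbrakk>x \<sim> y; y \<sim> z; x \<in> carrier G; y \<in> carrier G; z \<in> carrier G\<rbrakk> \<Longrightarrow> x \<sim> z"
  unfolding qo_equiv_def using leq_trans by blast

lemma less_leq_trans:
  "\<lbrakk>x \<prec> y; y \<lesssim> z; x \<in> carrier G; y \<in> carrier G; z \<in> carrier G\<rbrakk> \<Longrightarrow> x \<prec> z"
  by (simp add: less_iff) (meson leq_trans)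

lemma leq_less_trans:
  "\<lbrakk>x \<lesssim> y; y \<prec> z; x \<in> carrier G; y \<in> carrier G; z \<in> carrier G\<rbrakk> \<Longrightarrow> x \<prec> z"
  by (simp add: less_iff) (meson leq_trans)

lemma less_not_equiv: "x \<prec> y \<Longrightarrow> \<not> x \<sim> y" "x \<prec> y \<Longrightarrow> \<not> y \<sim> x"
  by (auto simp: qo_less_def qo_equiv_def)

lemma less_imp_leq: "x \<prec> y \<Longrightarrow> x \<lesssim> y"
  by (simp add: qo_less_def)

lemma equiv_imp_leq: "x \<sim> y \<Longrightarrow> x \<lesssim> y" "x \<sim> y \<Longrightarrow> y \<lesssim> x"
  by (auto simp: qo_equiv_def)

section \<open>Types of elements and position of their inverses\<close>

lemma o_plus_iff: "o_plus x \<longleftrightarrow> inv x \<prec> x"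
  by (simp add: o_plus_type_def)

lemma o_minus_iff: "x \<in> carrier G \<Longrightarrow> o_minus x \<longleftrightarrow> o_plus (inv x)"
  by (simp add: o_minus_type_def o_plus_type_def)

lemma type_cases:
  "x \<in> carrier G \<Longrightarrow> o_plus x \<or> v_type G (\<lesssim>) x \<or> o_minus x"
  by (auto simp: o_plus_type_def v_type_def o_minus_type_def equiv_iff)

lemma not_o_plus_one: "\<not> o_plus \<one>"
  using less_iff leq_refl by (simp add: o_plus_iff)

text \<open>Otherwise \<open>inv f \<prec> inv h\<close> and \<open>f \<prec> h\<close>. The first
  puts \<open>inv h \<otimes> f\<close> strictly above \<open>f\<close>, the second makes it
  equivalent to \<open>inv h\<close>, hence to \<open>f\<close>.\<close>

lemma o_plus_not_equiv_inv:
  assumes f: "o_plus f" and h: "o_plus h" and [simp]: "f \<in> carrier G" "h \<in> carrier G"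
  shows "\<not> f \<sim> inv h"
proof
  assume eq: "f \<sim> inv h"
  have "inv f \<prec> inv h"
    using f eq less_leq_trans equiv_imp_leq unfolding o_plus_iff by auto
  then have "f \<prec> inv h \<otimes> f"
    using less_translate(1)[of "inv f" "inv h"] by simp
  moreover have "f \<prec> h"
    using h eq leq_less_trans[of f "inv h" h] equiv_imp_leq unfolding o_plus_iff by auto
  then have "inv h \<otimes> f \<sim> inv h"
    using less_translate(4)[of f h] by simp
  ultimately show False
    using eq equiv_trans[of f "inv h" "inv h \<otimes> f"] equiv_sym less_not_equiv
    by (metis assms(3,4) inv_closed m_closed)
qed

text \<open>If \<open>c\<close> were not of \<open>o\<^sup>+\<close>-type, then
  \<open>h \<otimes> inv c\<close> would be of \<open>o\<^sup>+\<close>-type with inverse equivalent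
  to \<open>h\<close>, which \<open>o_plus_not_equiv_inv\<close> forbids.\<close>

lemma o_plus_equiv:
  assumes h: "o_plus h" and eq: "c \<sim> h" and [simp]: "c \<in> carrier G" "h \<in> carrier G"
  shows "o_plus c"
proof (rule ccontr)
  assume "\<not> o_plus c"
  then have "c \<lesssim> inv c"
    by (simp add: o_plus_iff less_iff)
  then have "h \<lesssim> inv c"
    using eq leq_trans[of h c "inv c"] equiv_imp_leq by simp
  then have "inv h \<prec> inv c"
    using h less_leq_trans[of "inv h" h "inv c"] unfolding o_plus_iff by auto
  then have "c \<otimes> inv h \<sim> c" and less: "h \<prec> h \<otimes> inv c"
    using less_translate(2,4)[of "inv h" "inv c"] by simp_all
  then have eq': "h \<sim> c \<otimes> inv h"
    using eq equiv_trans[of "c \<otimes> inv h" c h] equiv_commute by simp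
  then have "c \<otimes> inv h \<prec> h \<otimes> inv c"
    using less leq_less_trans[of "c \<otimes> inv h" h "h \<otimes> inv c"] equiv_imp_leq by simp
  then have "o_plus (h \<otimes> inv c)"
    by (simp add: o_plus_iff inv_mult_group)
  then show False
    using o_plus_not_equiv_inv[of h "h \<otimes> inv c"] h eq' by (simp add: inv_mult_group)
qed

text \<open>If \<open>inv a \<prec> inv g\<close>, then \<open>inv a \<otimes> g\<close> is
  equivalent to \<open>g\<close>, so it is of \<open>o\<^sup>+\<close>-type and its inverse
  \<open>inv g \<otimes> a\<close> lies below \<open>g \<sim> a\<close>. The same assumption puts
  that inverse strictly above \<open>a\<close>.\<close>

lemma inv_not_less_of_equiv:
  assumes g: "o_plus g" and eq: "a \<sim> g" and [simp]: "a \<in> carrier G" "g \<in> carrier G"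
  shows "\<not> inv a \<prec> inv g"
proof
  assume "inv a \<prec> inv g"
  then have k: "inv a \<otimes> g \<sim> g" "a \<prec> inv g \<otimes> a"
    using less_translate(1,3)[of "inv a" "inv g"] by simp_all
  then have "o_plus (inv a \<otimes> g)"
    using o_plus_equiv g by simp
  then have "inv g \<otimes> a \<prec> inv a \<otimes> g"
    by (simp add: o_plus_iff inv_mult_group)
  then have "inv g \<otimes> a \<prec> g"
    using k less_leq_trans[of "inv g \<otimes> a" "inv a \<otimes> g" g] equiv_imp_leq by simp
  then have "inv g \<otimes> a \<prec> a"
    using eq less_leq_trans[of "inv g \<otimes> a" g a] equiv_imp_leq by simp
  then show False
    using k(2) by (simp add: less_iff less_imp_leq)
qed

text \<open>For \<open>a \<prec> h\<close> the product \<open>a \<otimes> inv h\<close> is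
  equivalent to \<open>inv h\<close>. If \<open>inv h \<prec> inv a\<close> it is also equivalent to
  \<open>a\<close>, and if \<open>inv a \<prec> inv h\<close> it is strictly above \<open>a\<close>;
  both contradict \<open>inv h \<prec> a\<close>.\<close>

lemma o_plus_interval:
  assumes h: "o_plus h" and ha: "inv h \<prec> a" and ah: "a \<lesssim> h"
    and [simp]: "a \<in> carrier G" "h \<in> carrier G"
  shows "o_plus a" "inv a \<sim> inv h"
proof -
  have "o_plus a \<and> inv a \<sim> inv h"
  proof (cases "a \<sim> h")
    case True
    then have a: "o_plus a"
      using o_plus_equiv[OF h] by simp
    \<comment> \<open>Since \<open>a\<close> is of \<open>o\<^sup>+\<close>-type too, the preceding
      lemma applies with the roles of \<open>a\<close> and \<open>h\<close> exchanged and excludes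
      both strict comparisons.\<close>
    show ?thesis
      using inv_not_less_of_equiv[OF h True] inv_not_less_of_equiv[OF a equiv_sym[OF True]] a
      by (simp add: equiv_iff)
  next
    case False
    then have "a \<prec> h"
      using ah by (simp add: qo_less_def)
    then have ah': "a \<otimes> inv h \<sim> inv h"
      using less_translate by simp
    have not: "\<not> inv h \<prec> inv a"
    proof
      assume "inv h \<prec> inv a"
      then have "a \<otimes> inv h \<sim> a"
        using less_translate(4)[of "inv h" "inv a"] by simp
      then have "inv h \<sim> a"
        using ah' equiv_trans[of "inv h" "a \<otimes> inv h" a] equiv_commute by simp
      then show False
        using ha less_not_equiv by blast
    qed
    then have "inv a \<lesssim> inv h"
      by (simp add: less_iff)
    then have "o_plus a"
      using ha leq_less_trans[of "inv a" "inv h" a] by (simp add: o_plus_iff)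
    moreover have "\<not> inv a \<prec> inv h"
    proof
      assume "inv a \<prec> inv h"
      then have "a \<prec> a \<otimes> inv h"
        using less_translate(2)[of "inv a" "inv h"] by simp
      then have "a \<prec> inv h"
        using ah' less_leq_trans[of a "a \<otimes> inv h" "inv h"] equiv_imp_leq by simp
      then show False
        using ha by (simp add: less_iff less_imp_leq)
    qed
    ultimately show ?thesis
      using not by (simp add: equiv_iff)
  qed
  then show "o_plus a" "inv a \<sim> inv h"
    by simp_all
qed

text \<open>Since \<open>inv h\<close> is not of \<open>o\<^sup>+\<close>-type, it cannot lie
  between \<open>g\<close> and \<open>h\<close>; hence \<open>inv h \<prec> g\<close> and
  \<open>o_plus_interval\<close> applies to \<open>g\<close>.\<close>

lemma o_plus_interval_inv_equiv:
  assumes g: "o_plus g" and h: "o_plus h" and gh: "g \<lesssim> h"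
    and between: "\<And>c. \<lbrakk>c \<in> carrier G; g \<lesssim> c; c \<lesssim> h\<rbrakk> \<Longrightarrow> o_plus c"
    and [simp]: "g \<in> carrier G" "h \<in> carrier G"
  shows "inv g \<sim> inv h"
proof -
  have "\<not> g \<lesssim> inv h"
  proof
    assume "g \<lesssim> inv h"
    then have "o_plus (inv h)"
      using between[of "inv h"] h less_imp_leq unfolding o_plus_iff by simp
    then show False
      using h by (simp add: o_plus_iff less_iff less_imp_leq)
  qed
  then show ?thesis
    using o_plus_interval(2)[OF h _ gh] by (simp add: less_iff)
qed

section \<open>Membership in a type-component through the class of \<open>inv g\<close>\<close>

lemma type_comp_plus_iff:
  assumes g: "o_plus g" and [simp]: "g \<in> carrier G"
  shows "h \<in> type_comp_plus G (\<lesssim>) g \<longleftrightarrow> h \<in> carrier G \<and> o_plus h \<and> inv h \<sim> inv g"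
proof
  assume "h \<in> type_comp_plus G (\<lesssim>) g"
  then have h[simp]: "h \<in> carrier G" and oh: "o_plus h"
    and between: "\<And>c. c \<in> carrier G \<Longrightarrow> qo_between (\<lesssim>) g h c \<Longrightarrow> o_plus c"
    by (auto simp: type_comp_plus_def)
  have "inv h \<sim> inv g"
  proof (cases "g \<lesssim> h")
    case True
    have "inv g \<sim> inv h"
      by (rule o_plus_interval_inv_equiv[OF g oh True]) (simp_all add: between qo_between_def)
    then show ?thesis
      by (rule equiv_sym)
  next
    case False
    then have "h \<lesssim> g"
      using leq_total[of g h] by simp
    then show ?thesis
      by (rule o_plus_interval_inv_equiv[OF oh g]) (simp_all add: between qo_between_def)
  qed
  then show "h \<in> carrier G \<and> o_plus h \<and> inv h \<sim> inv g"
    using oh by simp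
next
  assume *: "h \<in> carrier G \<and> o_plus h \<and> inv h \<sim> inv g"
  \<comment> \<open>Stated for two endpoints in either role, as \<open>h\<close> may lie above or
    below \<open>g\<close>. The chain \<open>inv y \<sim> inv x \<prec> x \<lesssim> c\<close>
    provides the lower bound of \<open>o_plus_interval\<close>.\<close>
  have between: "o_plus c"
    if "o_plus x" "o_plus y" "inv x \<sim> inv y" "x \<lesssim> c" "c \<lesssim> y"
      and [simp]: "x \<in> carrier G" "y \<in> carrier G" "c \<in> carrier G" for x y c
  proof (rule o_plus_interval(1))
    have "inv x \<prec> c"
      using that less_leq_trans[of "inv x" x c] by (simp add: o_plus_iff)
    then show "inv y \<prec> c"
      using that leq_less_trans[of "inv y" "inv x" c] equiv_imp_leq by simp
  qed (use that in simp_all)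
  show "h \<in> type_comp_plus G (\<lesssim>) g"
    unfolding type_comp_plus_def qo_between_def
  proof (intro CollectI conjI ballI impI)
    fix c
    assume [simp]: "c \<in> carrier G" and c: "g \<lesssim> c \<and> c \<lesssim> h \<or> h \<lesssim> c \<and> c \<lesssim> g"
    then show "o_plus c"
      using between[OF g _ equiv_sym, of h c] between[OF _ g, of h c] * by auto
  qed (use * in simp_all)
qed

lemma type_comp_minus_iff:
  assumes "o_plus g" and [simp]: "g \<in> carrier G"
  shows "k \<in> type_comp_minus G (\<lesssim>) g \<longleftrightarrow> k \<in> carrier G \<and> o_minus k \<and> k \<sim> inv g"
proof
  assume "k \<in> type_comp_minus G (\<lesssim>) g"
  then show "k \<in> carrier G \<and> o_minus k \<and> k \<sim> inv g"
    by (auto simp: type_comp_minus_def type_comp_plus_iff[OF assms] o_minus_iff)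
next
  assume k: "k \<in> carrier G \<and> o_minus k \<and> k \<sim> inv g"
  then have "inv k \<in> type_comp_plus G (\<lesssim>) g"
    by (auto simp: type_comp_plus_iff[OF assms] o_minus_iff)
  then show "k \<in> type_comp_minus G (\<lesssim>) g"
    using k unfolding type_comp_minus_def by (auto intro!: exI[of _ "inv k"])
qed

lemma type_comp_iff:
  assumes "o_plus g" "g \<in> carrier G"
  shows "k \<in> type_comp G (\<lesssim>) g \<longleftrightarrow>
    k \<in> carrier G \<and> (o_plus k \<and> inv k \<sim> inv g \<or> o_minus k \<and> k \<sim> inv g)"
  by (auto simp: type_comp_def type_comp_plus_iff[OF assms] type_comp_minus_iff[OF assms])

lemma type_disjoint:
  "o_plus k \<Longrightarrow> \<not> o_minus k" "o_plus k \<Longrightarrow> \<not> v_type G (\<lesssim>) k" "o_minus k \<Longrightarrow> \<not> v_type G (\<lesssim>) k"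
  by (auto simp: o_plus_type_def o_minus_type_def v_type_def qo_less_def qo_equiv_def)

section \<open>Convexity, convexity complement and welding points\<close>

lemma type_comp_inv_leq:
  assumes "o_plus g" "s \<in> type_comp G (\<lesssim>) g" and [simp]: "g \<in> carrier G"
  shows "inv g \<lesssim> s"
proof -
  have [simp]: "s \<in> carrier G"
    using assms by (simp add: type_comp_iff)
  consider "o_plus s" "inv s \<sim> inv g" | "s \<sim> inv g"
    using assms by (auto simp: type_comp_iff)
  then show ?thesis
  proof cases
    case 1
    then have "inv g \<prec> s"
      using leq_less_trans[of "inv g" "inv s" s] equiv_imp_leq by (simp add: o_plus_iff)
    then show ?thesis
      by (rule less_imp_leq)
  qed (rule equiv_imp_leq)
qed

text \<open>An element \<open>t\<close> of the component strictly above \<open>inv g\<close> must be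
  of \<open>o\<^sup>+\<close>-type with \<open>inv t \<sim> inv g\<close>, so \<open>a\<close> falls
  under \<open>o_plus_interval\<close>. Convexity of the component can therefore fail only in its
  bottom class, that of \<open>inv g\<close>.\<close>

lemma type_comp_interval:
  assumes g: "o_plus g" and t: "t \<in> type_comp G (\<lesssim>) g"
    and less: "inv g \<prec> a" and at: "a \<lesssim> t" and [simp]: "a \<in> carrier G" "g \<in> carrier G"
  shows "a \<in> type_comp G (\<lesssim>) g"
proof -
  have [simp]: "t \<in> carrier G"
    using t g by (simp add: type_comp_iff)
  have "inv g \<prec> t"
    using less at by (rule less_leq_trans) simp_all
  then have "\<not> t \<sim> inv g"
    by (rule less_not_equiv)
  then have ot: "o_plus t" and eq: "inv t \<sim> inv g"
    using t g by (auto simp: type_comp_iff)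
  have "inv t \<prec> a"
    using eq less leq_less_trans[of "inv t" "inv g" a] equiv_imp_leq by simp
  from o_plus_interval[OF ot this at] show ?thesis
    using g eq equiv_trans[of "inv a" "inv t" "inv g"] by (simp add: type_comp_iff)
qed

lemma type_comp_right_convex:
  assumes "o_plus g" "g \<in> carrier G"
  shows "qo_right_convex (carrier G) (\<lesssim>) (type_comp G (\<lesssim>) g)"
  unfolding qo_right_convex_def
proof (intro conjI ballI impI)
  show "type_comp G (\<lesssim>) g \<subseteq> carrier G"
    using assms by (auto simp: type_comp_iff)
  fix s t a
  assume *: "s \<in> type_comp G (\<lesssim>) g" "t \<in> type_comp G (\<lesssim>) g" "a \<in> carrier G" "s \<prec> a \<and> a \<lesssim> t"
  then have "inv g \<prec> a"
    using type_comp_inv_leq[of g s] leq_less_trans[of "inv g" s a] assms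
    by (auto simp: type_comp_iff)
  then show "a \<in> type_comp G (\<lesssim>) g"
    using type_comp_interval[of g t a] * assms by simp
qed

lemma type_comp_strictly_convex:
  assumes "o_plus g" "g \<in> carrier G"
  shows "qo_strictly_convex (carrier G) (\<lesssim>) (type_comp G (\<lesssim>) g)"
  using type_comp_right_convex[OF assms] less_imp_leq
  unfolding qo_right_convex_def qo_strictly_convex_def by blast

lemma inv_mem_type_comp:
  "\<lbrakk>o_plus g; g \<in> carrier G\<rbrakk> \<Longrightarrow> inv g \<in> type_comp G (\<lesssim>) g"
  by (simp add: type_comp_iff o_minus_iff qo_equiv_def leq_refl)

lemma mem_qo_class: "x \<in> qo_class A (\<lesssim>) a \<longleftrightarrow> x \<in> A \<and> x \<sim> a"
  by (auto simp: qo_class_def qo_equiv_def)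

lemma qo_class_inv_not_o_plus:
  "\<lbrakk>o_plus g; g \<in> carrier G; x \<in> qo_class (carrier G) (\<lesssim>) (inv g)\<rbrakk> \<Longrightarrow> \<not> o_plus x"
  using o_plus_not_equiv_inv[of x g] by (auto simp: mem_qo_class)

lemma qo_class_eq_F_un_minus:
  assumes "o_plus g" "g \<in> carrier G"
  shows "qo_class (carrier G) (\<lesssim>) (inv g) = type_comp_F G (\<lesssim>) g \<union> type_comp_minus G (\<lesssim>) g"
  using qo_class_inv_not_o_plus[OF assms]
  by (auto simp: type_comp_F_def type_comp_minus_iff[OF assms] type_comp_iff[OF assms] mem_qo_class)

text \<open>The class of \<open>inv g\<close> has no \<open>o\<^sup>+\<close>-type elements, and all
  its \<open>o\<^sup>-\<close>-type elements are in the component.\<close>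

lemma v_type_F:
  assumes "o_plus g" "g \<in> carrier G" "x \<in> type_comp_F G (\<lesssim>) g"
  shows "v_type G (\<lesssim>) x"
  using assms qo_class_inv_not_o_plus[of g x] type_cases[of x]
  by (auto simp: type_comp_F_def type_comp_iff mem_qo_class)

lemma convexity_complement_F:
  assumes "o_plus g" "g \<in> carrier G"
  shows "is_convexity_complement (carrier G) (\<lesssim>) (type_comp G (\<lesssim>) g) (type_comp_F G (\<lesssim>) g)"
proof -
  let ?T = "type_comp G (\<lesssim>) g" and ?F = "type_comp_F G (\<lesssim>) g"
  have T: "?T \<subseteq> carrier G"
    using assms by (auto simp: type_comp_iff)
  have lower: "inv g \<lesssim> x" if "x \<in> ?T \<union> ?F" for x
    using that type_comp_inv_leq[of g x] assms
    by (auto simp: type_comp_F_def mem_qo_class equiv_imp_leq)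
  have "qo_convex (carrier G) (\<lesssim>) (?T \<union> ?F)"
    unfolding qo_convex_def
  proof (intro conjI ballI impI)
    show "?T \<union> ?F \<subseteq> carrier G"
      using T by (auto simp: type_comp_F_def mem_qo_class)
    fix s t a
    assume *: "s \<in> ?T \<union> ?F" "t \<in> ?T \<union> ?F" "a \<in> carrier G" "s \<lesssim> a \<and> a \<lesssim> t"
    then have [simp]: "s \<in> carrier G" "t \<in> carrier G"
      using T by (auto simp: type_comp_F_def mem_qo_class)
    have a: "inv g \<lesssim> a"
      using leq_trans[OF lower[OF *(1)], of a] * assms by simp
    show "a \<in> ?T \<union> ?F"
    proof (cases "a \<sim> inv g")
      case True
      then show ?thesis
        using * by (auto simp: type_comp_F_def mem_qo_class)
    next
      \<comment> \<open>Above the bottom class nothing of \<open>F\<close> is left, so the upper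
        bound \<open>t\<close> lies in the component itself.\<close>
      case False
      then have less: "inv g \<prec> a"
        using a by (simp add: qo_less_def equiv_commute)
      then have "inv g \<prec> t"
        using * assms less_leq_trans[of "inv g" a t] by simp
      then have "\<not> t \<sim> inv g"
        by (rule less_not_equiv)
      then have "t \<in> ?T"
        using * by (auto simp: type_comp_F_def mem_qo_class)
      then show ?thesis
        using type_comp_interval[of g t a] less * assms by simp
    qed
  qed
  \<comment> \<open>Minimality: each \<open>x\<close> of \<open>F\<close> satisfies
    \<open>inv g \<lesssim> x \<lesssim> inv g\<close> with \<open>inv g\<close> in the component,
    so convexity forces \<open>x\<close> into the union.\<close>
  moreover have "?F \<subseteq> T'" if T': "qo_convex (carrier G) (\<lesssim>) (?T \<union> T')" for T'
  proof
    fix x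
    assume x: "x \<in> ?F"
    then have "x \<in> carrier G" "inv g \<lesssim> x" "x \<lesssim> inv g" "x \<notin> ?T"
      by (auto simp: type_comp_F_def mem_qo_class qo_equiv_def)
    then show "x \<in> T'"
      using T' inv_mem_type_comp[OF assms] unfolding qo_convex_def by blast
  qed
  ultimately show ?thesis
    using type_comp_strictly_convex[OF assms]
    by (auto simp: is_convexity_complement_def type_comp_F_def)
qed

lemma convex_iff_F_empty:
  assumes "o_plus g" "g \<in> carrier G"
  shows "qo_convex (carrier G) (\<lesssim>) (type_comp G (\<lesssim>) g) \<longleftrightarrow> type_comp_F G (\<lesssim>) g = {}"
proof
  assume "qo_convex (carrier G) (\<lesssim>) (type_comp G (\<lesssim>) g)"
  \<comment> \<open>The empty set competes with \<open>F\<close> in the minimality of the convexity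
    complement.\<close>
  then have "qo_convex (carrier G) (\<lesssim>) (type_comp G (\<lesssim>) g \<union> {})"
    by simp
  then show "type_comp_F G (\<lesssim>) g = {}"
    using convexity_complement_F[OF assms] unfolding is_convexity_complement_def by blast
next
  assume "type_comp_F G (\<lesssim>) g = {}"
  then show "qo_convex (carrier G) (\<lesssim>) (type_comp G (\<lesssim>) g)"
    using convexity_complement_F[OF assms] by (simp add: is_convexity_complement_def)
qed

text \<open>As \<open>inv g\<close> is not v-type, only a v-type element of its class can witness
  welding, and such elements are exactly those of \<open>F\<close>.\<close>

lemma welding_point_inv_iff:
  assumes "o_plus g" "g \<in> carrier G"
  shows "welding_point G (\<lesssim>) (inv g) \<longleftrightarrow> type_comp_F G (\<lesssim>) g \<noteq> {}"
proof
  have om: "o_minus (inv g)"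
    using assms by (simp add: o_minus_iff)
  then have nv: "\<not> v_type G (\<lesssim>) (inv g)"
    by (rule type_disjoint)
  then have o: "o_type G (\<lesssim>) (inv g)"
    by (simp add: o_type_def v_type_def)
  {
    assume "welding_point G (\<lesssim>) (inv g)"
    then obtain x where "x \<in> carrier G" "x \<sim> inv g" "v_type G (\<lesssim>) x"
      using nv by (auto simp: welding_point_def)
    then have "x \<in> type_comp_F G (\<lesssim>) g"
      using assms by (auto dest: type_disjoint simp: type_comp_F_def mem_qo_class type_comp_iff)
    then show "type_comp_F G (\<lesssim>) g \<noteq> {}"
      by blast
  next
    assume "type_comp_F G (\<lesssim>) g \<noteq> {}"
    then obtain x where x: "x \<in> type_comp_F G (\<lesssim>) g"
      by blast
    then have v: "v_type G (\<lesssim>) x"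
      using v_type_F assms by blast
    then have "x \<noteq> inv g"
      using nv by blast
    moreover have "x \<in> carrier G" "x \<sim> inv g"
      using x by (auto simp: type_comp_F_def mem_qo_class)
    ultimately show "welding_point G (\<lesssim>) (inv g)"
      using v o unfolding welding_point_def by blast
  }
qed

section \<open>Maximality of the type-component\<close>

lemma type_comp_candidate:
  assumes g: "o_plus g" and [simp]: "g \<in> carrier G"
  shows "type_comp_candidate G (\<lesssim>) g (type_comp G (\<lesssim>) g)"
proof -
  let ?T = "type_comp G (\<lesssim>) g"
  have 1: "g \<in> ?T" "\<one> \<notin> ?T"
    using g not_o_plus_one by (auto simp: type_comp_iff o_minus_iff qo_equiv_def leq_refl)
  have 2: "\<forall>a\<in>?T. o_type G (\<lesssim>) a"
    using g by (auto dest: type_disjoint simp: type_comp_iff o_type_def v_type_def[symmetric])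
  have minus: "a \<sim> inv g" if "a \<in> ?T" "o_minus a" for a
    using that g by (auto dest: type_disjoint simp: type_comp_iff)
  have "a \<sim> b" if "a \<in> ?T" "b \<in> ?T" "o_minus a" "o_minus b" for a b
    using equiv_trans[of a "inv g" b] minus that equiv_commute g by (simp add: type_comp_iff)
  then have 3: "one_o_minus_class G (\<lesssim>) ?T"
    using inv_mem_type_comp[OF assms] g
    unfolding one_o_minus_class_def by (auto simp: o_minus_iff intro!: bexI[of _ "inv g"])
  have 4: "a \<prec> b" if ab: "a \<in> ?T" "b \<in> ?T" "o_minus a" "o_plus b" for a b
  proof -
    have c[simp]: "a \<in> carrier G" "b \<in> carrier G"
      using ab g by (auto simp: type_comp_iff)
    have "inv b \<sim> inv g"
      using ab g by (auto dest: type_disjoint simp: type_comp_iff)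
    then have "a \<sim> inv b"
      using minus[OF ab(1,3)] equiv_trans[of a "inv g" "inv b"] equiv_commute by simp
    then show ?thesis
      using leq_less_trans[of a "inv b" b] ab(4) equiv_imp_leq by (simp add: o_plus_iff)
  qed
  show ?thesis
    using type_comp_strictly_convex[OF assms] 1 2 3 4 by (auto simp: type_comp_candidate_def)
qed

text \<open>A single \<open>o\<^sup>-\<close>-type element \<open>k\<close> of \<open>S\<close>
  serves as a link: it is equivalent to the inverse of every \<open>o\<^sup>+\<close>-type element
  of \<open>S\<close>, in particular to \<open>inv g\<close>.\<close>

lemma type_comp_candidate_subset:
  assumes g: "o_plus g" and [simp]: "g \<in> carrier G"
    and S: "type_comp_candidate G (\<lesssim>) g S"
  shows "S \<subseteq> type_comp G (\<lesssim>) g"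
proof
  have car: "s \<in> carrier G" if "s \<in> S" for s
    using that S by (auto simp: type_comp_candidate_def qo_strictly_convex_def)
  have gS: "g \<in> S"
    using S by (simp add: type_comp_candidate_def)
  have minus: "k \<sim> inv b" if "k \<in> S" "o_minus k" "b \<in> S" "o_plus b" for k b
  proof -
    have [simp]: "k \<in> carrier G" "b \<in> carrier G"
      using that car by auto
    have kb: "k \<prec> b"
      using S that by (auto simp: type_comp_candidate_def)
    show ?thesis
    \<comment> \<open>If \<open>k \<prec> inv b\<close>, strict convexity places
      \<open>inv b\<close> in \<open>S\<close>, where there is only one \<open>o\<^sup>-\<close>
      class. If \<open>inv b \<prec> k\<close>, then \<open>k \<prec> b\<close> makes
      \<open>k\<close> of \<open>o\<^sup>+\<close>-type.\<close>
    proof (cases rule: less_cases[of k "inv b"])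
      assume "k \<prec> inv b"
      moreover have "inv b \<prec> b"
        using that by (simp add: o_plus_iff)
      moreover have "qo_strictly_convex (carrier G) (\<lesssim>) S"
        using S by (simp add: type_comp_candidate_def)
      ultimately have "inv b \<in> S"
        using that(1,3) unfolding qo_strictly_convex_def by (meson \<open>b \<in> carrier G\<close> inv_closed)
      moreover have "o_minus (inv b)"
        using that by (simp add: o_minus_iff)
      moreover have "one_o_minus_class G (\<lesssim>) S"
        using S by (simp add: type_comp_candidate_def)
      ultimately show ?thesis
        using that(1,2) unfolding one_o_minus_class_def by blast
    next
      assume "inv b \<prec> k"
      then have "o_plus k"
        using o_plus_interval(1)[OF that(4)] kb less_imp_leq by simp
      then show ?thesis
        using that type_disjoint by blast
    qed simp_all
  qed
  obtain k where k: "k \<in> S" "o_minus k"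
    using S by (auto simp: type_comp_candidate_def one_o_minus_class_def)
  fix a
  assume a: "a \<in> S"
  then have [simp]: "a \<in> carrier G"
    by (rule car)
  \<comment> \<open>The exclusion of \<open>\<one>\<close> from \<open>S\<close> enters here, as
    \<open>\<one>\<close> is both o-type and v-type.\<close>
  have "\<not> v_type G (\<lesssim>) a"
    using S a by (auto simp: type_comp_candidate_def o_type_def v_type_def)
  then consider "o_plus a" | "o_minus a"
    using type_cases[of a] by auto
  then show "a \<in> type_comp G (\<lesssim>) g"
  proof cases
    case 1
    have "inv a \<sim> inv g"
      by (rule equiv_trans[OF equiv_sym[OF minus[OF k a 1]] minus[OF k gS g]]) (simp_all add: car k)
    then show ?thesis
      using 1 g by (simp add: type_comp_iff)
  next
    case 2
    then show ?thesis
      using minus[OF a 2 gS g] g by (simp add: type_comp_iff)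
  qed
qed

section \<open>Multiplication inside a type-component\<close>

lemma type_comp_mult_mono:
  assumes g: "o_plus g" and [simp]: "g \<in> carrier G"
    and f1: "f1 \<in> carrier G" and f2: "f2 \<in> type_comp G (\<lesssim>) g" "o_plus f2"
    and h: "h \<in> type_comp G (\<lesssim>) g" "o_plus h" and le: "f1 \<lesssim> f2"
  shows "f1 \<otimes> h \<lesssim> f2 \<otimes> h" "h \<otimes> f1 \<lesssim> h \<otimes> f2"
proof -
  have [simp]: "f2 \<in> carrier G" "h \<in> carrier G"
    and eq: "inv f2 \<sim> inv g" "inv h \<sim> inv g"
    using f2 h type_disjoint(1) by (auto simp: type_comp_iff[OF g assms(2)])
  \<comment> \<open>Lying in the same component yields
    \<open>inv h \<sim> inv f2 \<prec> f2\<close>, the side condition of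
    \<open>mult_mono\<close>.\<close>
  have "inv h \<sim> inv f2"
    by (rule equiv_trans[OF eq(2) equiv_sym[OF eq(1)]]) simp_all
  then have "inv h \<prec> f2"
    using leq_less_trans[of "inv h" "inv f2" f2] f2 equiv_imp_leq by (simp add: o_plus_iff)
  from mult_mono[OF le this f1] show "f1 \<otimes> h \<lesssim> f2 \<otimes> h" "h \<otimes> f1 \<lesssim> h \<otimes> f2"
    by simp_all
qed

end

theorem proposition3p15:
  fixes G :: "('a, 'b) monoid_scheme" (structure)
    and leq :: "'a \<Rightarrow> 'a \<Rightarrow> bool" (infix "\<lesssim>" 50)
    and g :: 'a
  assumes "C_quasi_ordered_group G (\<lesssim>)"
    and "g \<in> carrier G"
    and "o_plus_type G (\<lesssim>) g"
  shows
    "(qo_right_convex (carrier G) (\<lesssim>) (type_comp G (\<lesssim>) g) \<and>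
      is_convexity_complement (carrier G) (\<lesssim>) (type_comp G (\<lesssim>) g) (type_comp_F G (\<lesssim>) g) \<and>
      qo_class (carrier G) (\<lesssim>) (inv g) = type_comp_F G (\<lesssim>) g \<union> type_comp_minus G (\<lesssim>) g \<and>
      (\<forall>x \<in> type_comp_F G (\<lesssim>) g. v_type G (\<lesssim>) x)) \<and>
     (qo_convex (carrier G) (\<lesssim>) (type_comp G (\<lesssim>) g) \<longleftrightarrow> \<not> welding_point G (\<lesssim>) (inv g)) \<and>
     (type_comp_candidate G (\<lesssim>) g (type_comp G (\<lesssim>) g) \<and>
      (\<forall>S. type_comp_candidate G (\<lesssim>) g S \<longrightarrow> S \<subseteq> type_comp G (\<lesssim>) g)) \<and>
     (\<forall>f1 \<in> type_comp G (\<lesssim>) g. \<forall>f2 \<in> type_comp G (\<lesssim>) g. \<forall>h \<in> type_comp G (\<lesssim>) g.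
        o_plus_type G (\<lesssim>) f1 \<and> o_plus_type G (\<lesssim>) f2 \<and> o_plus_type G (\<lesssim>) h \<and> f1 \<lesssim> f2 \<longrightarrow>
        f1 \<otimes> h \<lesssim> f2 \<otimes> h \<and> h \<otimes> f1 \<lesssim> h \<otimes> f2)"
proof -
  interpret C_quasi_ordered_group G "(\<lesssim>)"
    by fact
  note g = assms(3,2)
  show ?thesis
  proof (intro conjI ballI allI impI)
    show "qo_convex (carrier G) (\<lesssim>) (type_comp G (\<lesssim>) g) \<longleftrightarrow> \<not> welding_point G (\<lesssim>) (inv g)"
      using convex_iff_F_empty[OF g] welding_point_inv_iff[OF g] by simp
  next
    fix f1 f2 h
    assume "f1 \<in> type_comp G (\<lesssim>) g" "f2 \<in> type_comp G (\<lesssim>) g" "h \<in> type_comp G (\<lesssim>) g"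
      and "o_plus f1 \<and> o_plus f2 \<and> o_plus h \<and> f1 \<lesssim> f2"
    then show "f1 \<otimes> h \<lesssim> f2 \<otimes> h" "h \<otimes> f1 \<lesssim> h \<otimes> f2"
      using type_comp_mult_mono[OF g, of f1 f2 h] type_comp_iff[OF g, of f1] by simp_all
  qed (fact type_comp_right_convex[OF g] convexity_complement_F[OF g]
      qo_class_eq_F_un_minus[OF g] v_type_F[OF g] type_comp_candidate[OF g]
      type_comp_candidate_subset[OF g])+
qed

end
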